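(* Let $0<\alpha\le1$ and let $X$ be a super-reflexive Banach space that has an equivalent norm with modulus of smoothness of power type $1+\alpha$. Let $E\subset X$ and let $f$ be a real function on $E$. Then $f$ can be extended to a function $F\in C^{1,\alpha}(X)$ if and only if the following condition holds: there exist a mapping $G\colon E\to X^*$ and $M>0$ such that $$\|G(y)-G(x)\|\le M\|y-x\|^\alpha,$$ $$|f(y)-f(x)-\langle G(x),y-x\rangle|\le M\|y-x\|^{1+\alpha}$$ for each $x,y\in E$. Moreover, if this condition is satisfied with a mapping $G$, then $F$ can be found such that $DF(x)=G(x)$ for each $x\in E$.
   Context: All normed linear spaces are real; $\langle g,x\rangle=g(x)$ for $g\in X^*$, $x\in X$, and $DF$ denotes the Fréchet derivative of $F$. For an open subset $U$ of a normed linear space and $0<\alpha\le1$, $C^{1,\alpha}(U)$ is the set of all Fréchet differentiable $f\colon U\to\mathbb R$ such that $Df$ is $\alpha$-Hölder on $U$, i.e. there is $C>0$ with $\|Df(x)-Df(y)\|\le C\|x-y\|^\alpha$ for all $x,y\in U$. The modulus of smoothness of a norm $\|\cdot\|$ on $X$ is $\rho(\tau)=\sup\{\frac{\|x+\tau y\|+\|x-\tau y\|}{2}-1 : x,y\in X,\ \|x\|=\|y\|=1\}$, $\tau\ge0$; it is of power type $p>1$ if there is $K>0$ with $\rho(\tau)\le K\tau^p$ for all $\tau\ge0$. A Banach space is super-reflexive if and only if it has an equivalent uniformly smooth norm. *)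

theory Defs
  imports "HOL-Analysis.Analysis"
begin

definition is_norm :: "('a::real_vector \<Rightarrow> real) \<Rightarrow> bool" where
  "is_norm N \<longleftrightarrow>
     (\<forall>x. N x = 0 \<longleftrightarrow> x = 0) \<and>
     (\<forall>c x. N (c *\<^sub>R x) = \<bar>c\<bar> * N x) \<and>
     (\<forall>x y. N (x + y) \<le> N x + N y)"

definition equivalent_norm :: "('a::real_normed_vector \<Rightarrow> real) \<Rightarrow> bool" where
  "equivalent_norm N \<longleftrightarrow>
     is_norm N \<and> (\<exists>a>0. \<exists>b>0. \<forall>x. a * norm x \<le> N x \<and> N x \<le> b * norm x)"

text \<open>For a norm \<open>N\<close> and \<open>\<tau> \<ge> 0\<close> the set below is bounded above by \<open>\<tau>\<close> and consists of
  nonnegative numbers. Inserting \<open>0\<close> therefore changes nothing unless the space is \<open>{0}\<close>,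
  where there are no unit vectors; there it makes the modulus \<open>0\<close> instead of the
  unspecified real number \<open>Sup {}\<close>.\<close>

definition modulus_of_smoothness :: "('a::real_vector \<Rightarrow> real) \<Rightarrow> real \<Rightarrow> real" where
  "modulus_of_smoothness N \<tau> =
     Sup (insert 0 {(N (x + \<tau> *\<^sub>R y) + N (x - \<tau> *\<^sub>R y)) / 2 - 1 | x y. N x = 1 \<and> N y = 1})"

definition smoothness_power_type :: "('a::real_vector \<Rightarrow> real) \<Rightarrow> real \<Rightarrow> bool" where
  "smoothness_power_type N p \<longleftrightarrow>
     p > 1 \<and> (\<exists>K>0. \<forall>\<tau>\<ge>0. modulus_of_smoothness N \<tau> \<le> K * \<tau> powr p)"

definition uniformly_smooth :: "('a::real_vector \<Rightarrow> real) \<Rightarrow> bool" where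
  "uniformly_smooth N \<longleftrightarrow> ((\<lambda>\<tau>. modulus_of_smoothness N \<tau> / \<tau>) \<longlongrightarrow> 0) (at_right 0)"

text \<open>Super-reflexivity is taken in the form of Enflo's theorem, as the existence of an
  equivalent uniformly smooth norm. The definition by finite representability
  would quantify over all Banach spaces, i.e. over types.\<close>

definition super_reflexive :: "'a::banach itself \<Rightarrow> bool" where
  "super_reflexive (_ :: 'a itself) \<longleftrightarrow>
     (\<exists>N :: 'a \<Rightarrow> real. equivalent_norm N \<and> uniformly_smooth N)"

text \<open>\<open>C1_holder \<alpha> U\<close> is the class \<open>C\<^sup>1\<^sup>,\<^sup>\<alpha>(U)\<close>, meant for open \<open>U\<close>, where the
  Frechet derivative \<open>Df x\<close> is unique. Only the values of its members on \<open>U\<close> matter.\<close>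

definition C1_holder :: "real \<Rightarrow> 'a::real_normed_vector set \<Rightarrow> ('a \<Rightarrow> real) set" where
  "C1_holder \<alpha> U =
     {f. \<exists>Df :: 'a \<Rightarrow> 'a \<Rightarrow>\<^sub>L real.
           (\<forall>x\<in>U. (f has_derivative blinfun_apply (Df x)) (at x)) \<and>
           (\<exists>C>0. \<forall>x\<in>U. \<forall>y\<in>U. norm (Df x - Df y) \<le> C * norm (x - y) powr \<alpha>)}"

end

theory Submission
  imports Defs
begin

text \<open>
  The necessity of the condition is the mean value inequality. For the sufficiency, work with
  second differences \<open>F (x + h) + F (x - h) - 2 * F x\<close>. Put \<open>p = 1 + \<alpha>\<close> and let \<open>\<phi>\<close> be the
  \<open>p\<close>-th power of the smooth norm. The power type of its modulus implies that the second difference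
  of \<open>\<phi>\<close> is at most a multiple of \<open>\<parallel>h\<parallel>\<^sup>p\<close> (\<open>smooth_norm_powr_second_difference\<close>). Hence, for
  \<open>y \<in> E\<close>, the second differences of
  \<open>u\<^sub>y(x) = f y + \<langle>G y, x - y\<rangle> + A \<phi>(x - y)\<close> are bounded above, and those of
  \<open>l\<^sub>y(x) = f y + \<langle>G y, x - y\<rangle> - A \<phi>(x - y)\<close> are bounded below, by multiples of \<open>\<parallel>h\<parallel>\<^sup>p\<close>. The
  hypothesis on \<open>f\<close> and \<open>G\<close> makes every \<open>l\<^sub>y\<close> lie below every \<open>u\<^sub>z\<close> once \<open>A\<close> is large.

  The heart of the matter is to insert between the two families one function \<open>F\<close> whose second
  differences are bounded on both sides (\<open>second_difference_insertion\<close>): \<open>F\<close> is simply the largest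
  function that stays below all \<open>u\<^sub>z\<close> and has the lower bound. The upper bound is then automatic,
  because the average of two translates of \<open>F\<close>, lowered by the allowed defect, is again a
  competitor and so lies below \<open>F\<close>.

  A locally bounded function with second differences \<open>O(\<parallel>h\<parallel>\<^sup>p)\<close>, \<open>p > 1\<close>, has a first order Taylor
  expansion with remainder \<open>O(\<parallel>h\<parallel>\<^sup>p)\<close> uniformly in the base point
  (\<open>second_difference_imp_taylor\<close>), and such an expansion forces the derivative to be
  \<open>\<alpha>\<close>-Hoelder. Finally, \<open>F\<close> is squeezed between \<open>l\<^sub>y\<close> and \<open>u\<^sub>y\<close>, which touch at \<open>y\<close> with common
  derivative \<open>G y\<close>, so that \<open>F y = f y\<close> and \<open>DF(y) = G y\<close>.
\<close>

section \<open>Insertion of a function with small second differences\<close>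

definition second_difference :: "('a::real_vector \<Rightarrow> real) \<Rightarrow> 'a \<Rightarrow> 'a \<Rightarrow> real" where
  "second_difference F x h = F (x + h) + F (x - h) - 2 * F x"

text \<open>A version of Ilmanen's lemma. Everything rests on the class of functions with second
  differences at least \<open>-\<omega>\<close> being closed under suprema, translations and averages, so that the
  largest member below \<open>U\<close> exists and competes with the averages of its own translates.\<close>

lemma second_difference_insertion:
  fixes U L :: "('a::real_vector \<Rightarrow> real) set" and \<omega> :: "'a \<Rightarrow> real"
  assumes "U \<noteq> {}" "L \<noteq> {}"
    and U: "\<And>u x h. u \<in> U \<Longrightarrow> second_difference u x h \<le> \<omega> h"
    and L: "\<And>l x h. l \<in> L \<Longrightarrow> - \<omega> h \<le> second_difference l x h"
    and LU: "\<And>l u x. l \<in> L \<Longrightarrow> u \<in> U \<Longrightarrow> l x \<le> u x"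
  obtains F where "\<And>x h. \<bar>second_difference F x h\<bar> \<le> \<omega> h"
    and "\<And>l x. l \<in> L \<Longrightarrow> l x \<le> F x" and "\<And>u x. u \<in> U \<Longrightarrow> F x \<le> u x"
proof -
  define S where "S = {s. (\<forall>x h. - \<omega> h \<le> second_difference s x h) \<and> (\<forall>u\<in>U. \<forall>x. s x \<le> u x)}"
  define F where "F x = (SUP s\<in>S. s x)" for x
  obtain u0 where u0: "u0 \<in> U" using \<open>U \<noteq> {}\<close> by auto
  have LS: "L \<subseteq> S" using L LU by (auto simp: S_def)
  then have "S \<noteq> {}" using \<open>L \<noteq> {}\<close> by auto
  have bdd: "bdd_above ((\<lambda>s. s x) ` S)" for x
    using u0 by (intro bdd_aboveI[of _ "u0 x"]) (auto simp: S_def)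
  have upper: "s x \<le> F x" if "s \<in> S" for s x
    unfolding F_def by (rule cSUP_upper[OF that bdd])
  have least: "F x \<le> c" if "\<And>s. s \<in> S \<Longrightarrow> s x \<le> c" for x c
    unfolding F_def by (rule cSUP_least[OF \<open>S \<noteq> {}\<close> that])
  have FU: "F x \<le> u x" if "u \<in> U" for u x
    by (rule least) (use that in \<open>auto simp: S_def\<close>)
  have lower: "- \<omega> h \<le> second_difference F x h" for x h
  proof -
    have "F x \<le> (F (x + h) + F (x - h) + \<omega> h) / 2"
    proof (rule least)
      fix s assume s: "s \<in> S"
      then have "- \<omega> h \<le> second_difference s x h" by (auto simp: S_def)
      then show "s x \<le> (F (x + h) + F (x - h) + \<omega> h) / 2"
        using upper[OF s, of "x + h"] upper[OF s, of "x - h"]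
        unfolding second_difference_def by (simp add: field_simps)
    qed
    then show ?thesis unfolding second_difference_def by (simp add: field_simps)
  qed
  have "second_difference F x h \<le> \<omega> h" for x h
  proof -
    define s where "s z = (F (z + h) + F (z - h)) / 2 - \<omega> h / 2" for z
    have "s \<in> S"
      unfolding S_def
    proof (intro CollectI conjI allI ballI)
      fix z k
      have "second_difference s z k
        = (second_difference F (z + h) k + second_difference F (z - h) k) / 2"
        unfolding second_difference_def s_def by (simp add: algebra_simps add_divide_distrib)
      then show "- \<omega> k \<le> second_difference s z k"
        using lower[of k "z + h"] lower[of k "z - h"] by (simp add: field_simps)
    next
      fix u z assume u: "u \<in> U"
      show "s z \<le> u z"
        using U[OF u, of z h] FU[OF u, of "z + h"] FU[OF u, of "z - h"]
        unfolding s_def second_difference_def by (simp add: field_simps)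
    qed
    from upper[OF this, of x] show ?thesis
      unfolding s_def second_difference_def by (simp add: field_simps)
  qed
  with lower have "\<bar>second_difference F x h\<bar> \<le> \<omega> h" for x h 
    by (intro abs_leI) (simp_all add: minus_le_iff[of "second_difference F x h"])
  moreover have "l x \<le> F x" if "l \<in> L" for l x using LS upper that by blast
  ultimately show thesis using FU by (rule that)
qed

section \<open>From second differences to Taylor expansions\<close>

text \<open>The defect of homogeneity \<open>L (t *\<^sub>R h) - t * L h\<close> is additive in \<open>t\<close> and vanishes at
  \<open>t = 1\<close>. It is therefore \<open>1\<close>-periodic; being bounded on \<open>[0, 1]\<close> it is bounded everywhere, and a
  bounded additive function is \<open>0\<close>.\<close>

lemma additive_locally_bounded_imp_bounded_linear:
  fixes L :: "'a::real_normed_vector \<Rightarrow> real"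
  assumes add: "\<And>x y. L (x + y) = L x + L y"
    and "\<delta> > 0" and bnd: "\<And>x. norm x \<le> \<delta> \<Longrightarrow> \<bar>L x\<bar> \<le> K"
  shows "bounded_linear L"
proof -
  have zero: "L 0 = 0" using add[of 0 0] by simp
  have minus: "L (- x) = - L x" for x using add[of x "-x"] zero by simp
  have nat: "L (of_nat n *\<^sub>R x) = of_nat n * L x" for n x
    by (induction n) (auto simp: zero add algebra_simps)
  have int: "L (of_int n *\<^sub>R x) = of_int n * L x" for n x
    by (cases n rule: int_cases2) (auto simp: nat minus)
  have hom: "L (t *\<^sub>R h) = t * L h" for t h
  proof -
    obtain m :: nat where m: "norm h / \<delta> < of_nat m" using reals_Archimedean2 by blast
    have "m > 0" using m \<open>\<delta> > 0\<close> by (metis divide_nonneg_pos gr0I leD norm_ge_zero of_nat_0)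
    define B where "B = of_nat m * K + \<bar>L h\<bar>"
    have frac_bound: "\<bar>L (s *\<^sub>R h) - s * L h\<bar> \<le> B" if "0 \<le> s" "s \<le> 1" for s
    proof -
      have "norm ((s / of_nat m) *\<^sub>R h) = s * (norm h / of_nat m)" using that by simp
      also have "\<dots> \<le> 1 * (norm h / of_nat m)" using that by (intro mult_right_mono) auto
      also have "\<dots> \<le> \<delta>" using m \<open>m > 0\<close> \<open>\<delta> > 0\<close> by (simp add: field_simps)
      finally have "\<bar>L ((s / of_nat m) *\<^sub>R h)\<bar> \<le> K" by (rule bnd)
      moreover have "L (s *\<^sub>R h) = of_nat m * L ((s / of_nat m) *\<^sub>R h)"
        using nat[of m "(s / of_nat m) *\<^sub>R h"] \<open>m > 0\<close> by simp
      ultimately have "\<bar>L (s *\<^sub>R h)\<bar> \<le> of_nat m * K"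
        by (simp add: abs_mult mult_left_mono)
      moreover have "\<bar>s * L h\<bar> \<le> \<bar>L h\<bar>" using that by (simp add: abs_mult mult_left_le_one_le)
      ultimately show ?thesis unfolding B_def by linarith
    qed
    have "of_nat n * \<bar>L (t *\<^sub>R h) - t * L h\<bar> \<le> B" for n :: nat
    proof -
      define s where "s = frac (of_nat n * t)"
      have "of_nat n * t = of_int \<lfloor>of_nat n * t\<rfloor> + s" by (simp add: s_def frac_def)
      then obtain k :: int where k: "of_nat n * t = of_int k + s" by blast
      have "of_nat n * L (t *\<^sub>R h) = L ((of_nat n * t) *\<^sub>R h)"
        using nat[of n "t *\<^sub>R h"] by simp
      also have "\<dots> = of_int k * L h + L (s *\<^sub>R h)"
        unfolding k by (simp add: scaleR_add_left add int)
      finally have "of_nat n * (L (t *\<^sub>R h) - t * L h)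
          = of_int k * L h + L (s *\<^sub>R h) - (of_nat n * t) * L h"
        by (simp add: algebra_simps)
      also have "\<dots> = L (s *\<^sub>R h) - s * L h" unfolding k by (simp add: algebra_simps)
      finally have "of_nat n * \<bar>L (t *\<^sub>R h) - t * L h\<bar> = \<bar>L (s *\<^sub>R h) - s * L h\<bar>"
        by (metis abs_mult abs_of_nat)
      also have "\<dots> \<le> B"
        by (rule frac_bound) (auto simp: s_def frac_ge_0 frac_lt_1 less_imp_le)
      finally show ?thesis .
    qed
    then have "\<bar>L (t *\<^sub>R h) - t * L h\<bar> = 0"
      using ex_less_of_nat_mult[of "\<bar>L (t *\<^sub>R h) - t * L h\<bar>" B] by (fastforce simp: not_less[symmetric])
    then show ?thesis by simp
  qed
  show ?thesis
  proof (rule bounded_linear_intro[where K = "K / \<delta>"])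
    show "norm (L x) \<le> norm x * (K / \<delta>)" for x
    proof (cases "x = 0")
      case False
      have "\<bar>L ((\<delta> / norm x) *\<^sub>R x)\<bar> \<le> K" using False \<open>\<delta> > 0\<close> by (intro bnd) simp
      then show ?thesis using False \<open>\<delta> > 0\<close> by (simp add: hom abs_mult field_simps)
    qed (simp add: zero)
  qed (simp_all add: add hom)
qed

text \<open>The derivative at \<open>x\<close> in direction \<open>h\<close> is the limit of the dyadic difference quotients
  \<open>2 ^ k * (F (x + h / 2 ^ k) - F x)\<close>. Consecutive quotients differ by \<open>2 ^ k\<close> times a second
  difference with step \<open>h / 2 ^ (k + 1)\<close>, that is by \<open>O(\<parallel>h\<parallel>\<^sup>p q\<^sup>k)\<close> with \<open>q = 2 powr (1 - p) < 1\<close>;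
  summing the geometric series gives both the limit and the remainder. The same estimate shows
  that the limit is additive in \<open>h\<close>, and local boundedness of \<open>F\<close> makes it bounded.\<close>

lemma second_difference_imp_taylor:
  fixes F :: "'a::real_normed_vector \<Rightarrow> real"
  assumes "p > 1"
    and sd: "\<And>x h. \<bar>second_difference F x h\<bar> \<le> B * norm h powr p"
    and loc: "\<And>x. \<exists>K. \<forall>h. norm h \<le> 1 \<longrightarrow> \<bar>F (x + h)\<bar> \<le> K"
  obtains DF :: "'a \<Rightarrow> 'a \<Rightarrow>\<^sub>L real" and C where "C \<ge> 0"
    and "\<And>x h. \<bar>F (x + h) - F x - DF x h\<bar> \<le> C * norm h powr p"
proof -
  define q :: real where "q = 2 powr (1 - p)"
  have q: "0 < q" "q < 1" using \<open>p > 1\<close> by (auto simp: q_def powr_less_one)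
  have scale: "\<bar>2 ^ k * second_difference F x ((1 / 2 ^ Suc k) *\<^sub>R h)\<bar>
      \<le> (\<bar>B\<bar> * norm h powr p) * q ^ k" for x h k
  proof -
    have pw: "2 ^ k * (1 / 2 ^ Suc k) powr p \<le> q ^ k"
    proof -
      have "2 ^ k * (1 / 2 ^ Suc k) powr p = (2::real) powr (real k - p * real (Suc k))"
        by (simp add: powr_realpow[symmetric] powr_diff powr_powr powr_divide mult.commute
            del: of_nat_Suc power_Suc)
      also have "\<dots> \<le> 2 powr (real k * (1 - p))"
        using \<open>p > 1\<close> by (intro powr_mono) (auto simp: algebra_simps)
      also have "\<dots> = q ^ k"
        by (simp add: q_def powr_realpow[symmetric] powr_powr mult.commute)
      finally show ?thesis .
    qed
    have "\<bar>2 ^ k * second_difference F x ((1 / 2 ^ Suc k) *\<^sub>R h)\<bar>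
        = 2 ^ k * \<bar>second_difference F x ((1 / 2 ^ Suc k) *\<^sub>R h)\<bar>"
      by (simp add: abs_mult)
    also have "\<dots> \<le> 2 ^ k * (B * norm ((1 / 2 ^ Suc k) *\<^sub>R h) powr p)"
      by (intro mult_left_mono sd) simp
    also have "\<dots> \<le> 2 ^ k * (\<bar>B\<bar> * norm ((1 / 2 ^ Suc k) *\<^sub>R h) powr p)"
      by (intro mult_left_mono mult_right_mono) auto
    also have "\<dots> = (\<bar>B\<bar> * norm h powr p) * (2 ^ k * (1 / 2 ^ Suc k) powr p)"
      by (simp only: norm_scaleR powr_mult abs_ge_zero norm_ge_zero mult_ac)
        (simp del: power_Suc)
    also have "\<dots> \<le> (\<bar>B\<bar> * norm h powr p) * q ^ k"
      by (intro mult_left_mono pw) auto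
    finally show ?thesis .
  qed
  define D where "D x h k = 2 ^ k * (F (x + (1 / 2 ^ k) *\<^sub>R h) - F x)" for x h and k :: nat
  have half: "(1 / 2 ^ k) *\<^sub>R h = 2 *\<^sub>R ((1 / 2 ^ Suc k) *\<^sub>R h)" for k and h :: 'a by simp
  have step: "\<bar>D x h (Suc k) - D x h k\<bar> \<le> (\<bar>B\<bar> * norm h powr p) * q ^ k" for x h k
  proof -
    define v where "v = (1 / 2 ^ Suc k) *\<^sub>R h"
    have "D x h (Suc k) - D x h k = - (2 ^ k * second_difference F (x + v) v)"
      unfolding D_def second_difference_def half[of k] v_def[symmetric]
      by (simp add: algebra_simps scaleR_2)
    then show ?thesis using scale[of k "x + v" h] unfolding v_def[symmetric] by simp
  qed
  define C where "C = \<bar>B\<bar> / (1 - q)"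
  have "C \<ge> 0" using q by (simp add: C_def)
  define L where "L x h = lim (D x h)" for x h
  have lim: "D x h \<longlonglongrightarrow> L x h" and rem: "\<bar>F (x + h) - F x - L x h\<bar> \<le> C * norm h powr p" for x h
  proof -
    let ?d = "\<lambda>k. D x h (Suc k) - D x h k" and ?g = "\<lambda>k. (\<bar>B\<bar> * norm h powr p) * q ^ k"
    have g: "?g sums (C * norm h powr p)"
      using sums_mult[OF geometric_sums[of q], of "\<bar>B\<bar> * norm h powr p"] q by (simp add: C_def)
    have sd': "summable (\<lambda>k. \<bar>?d k\<bar>)"
      by (rule summable_comparison_test'[OF sums_summable[OF g], of 0]) (use step in simp)
    then have sdd: "summable ?d" by (rule summable_rabs_cancel)
    have "(\<lambda>n. D x h n - D x h 0) \<longlonglongrightarrow> suminf ?d"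
      using summable_LIMSEQ[OF sdd] by (simp add: sum_lessThan_telescope)
    from tendsto_add[OF this tendsto_const[of "D x h 0"]]
    have D: "D x h \<longlonglongrightarrow> suminf ?d + D x h 0" by simp
    then show "D x h \<longlonglongrightarrow> L x h" unfolding L_def by (simp add: limI)
    from D have Leq: "L x h = suminf ?d + D x h 0" unfolding L_def by (rule limI)
    have "\<bar>suminf ?d\<bar> \<le> (\<Sum>k. \<bar>?d k\<bar>)" by (rule summable_rabs[OF sd'])
    also have "\<dots> \<le> suminf ?g" by (rule suminf_le[OF step sd' sums_summable[OF g]])
    also have "\<dots> = C * norm h powr p" using g by (rule sums_unique[symmetric])
    finally show "\<bar>F (x + h) - F x - L x h\<bar> \<le> C * norm h powr p"
      unfolding Leq by (simp add: D_def)
  qed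
  have L0: "L x 0 = 0" for x using rem[of x 0] \<open>p > 1\<close> by simp
  have mid: "L x h + L x k = L x (h + k)" for x h k
  proof -
    \<comment> \<open>Jensen's equation holds because its defect is a limit of rescaled second differences.
      Since \<open>(h, k)\<close> and \<open>(h + k, 0)\<close> have the same midpoint and \<open>L x 0 = 0\<close>, it yields
      additivity.\<close>
    have jensen: "L x a + L x b = 2 * L x ((1/2) *\<^sub>R (a + b))" for a b
    proof -
      have "D x a n + D x b n - 2 * D x ((1/2) *\<^sub>R (a + b)) n
          = 2 ^ n * second_difference F (x + (1 / 2 ^ Suc n) *\<^sub>R (a + b))
              ((1 / 2 ^ Suc n) *\<^sub>R (a - b))" for n
        unfolding D_def second_difference_def half[of n]
        by (simp add: algebra_simps scaleR_2[symmetric])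
      then have "\<bar>D x a n + D x b n - 2 * D x ((1/2) *\<^sub>R (a + b)) n\<bar>
          \<le> (\<bar>B\<bar> * norm (a - b) powr p) * q ^ n" for n
        using scale[of n _ "a - b"] by (simp only:)
      moreover have "(\<lambda>n. (\<bar>B\<bar> * norm (a - b) powr p) * q ^ n) \<longlonglongrightarrow> 0"
        using q by (intro tendsto_mult_right_zero LIMSEQ_realpow_zero) auto
      ultimately have "(\<lambda>n. D x a n + D x b n - 2 * D x ((1/2) *\<^sub>R (a + b)) n) \<longlonglongrightarrow> 0"
        unfolding real_norm_def[symmetric]
        by (rule Lim_null_comparison[OF always_eventually[OF allI]])
      moreover have "(\<lambda>n. D x a n + D x b n - 2 * D x ((1/2) *\<^sub>R (a + b)) n)
          \<longlonglongrightarrow> L x a + L x b - 2 * L x ((1/2) *\<^sub>R (a + b))"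
        by (intro tendsto_intros lim)
      ultimately show ?thesis using LIMSEQ_unique by force
    qed
    show ?thesis using jensen[of h k] jensen[of "h + k" 0] by (simp add: L0)
  qed
  have lin: "bounded_linear (L x)" for x
  proof -
    obtain K where K: "norm h \<le> 1 \<Longrightarrow> \<bar>F (x + h)\<bar> \<le> K" for h using loc by blast
    show ?thesis
    proof (rule additive_locally_bounded_imp_bounded_linear[of _ 1 "2 * K + C"])
      fix h :: 'a assume h: "norm h \<le> 1"
      have "norm h powr p \<le> 1" using h \<open>p > 1\<close> by (intro powr_le1) auto
      then have "C * norm h powr p \<le> C" using \<open>C \<ge> 0\<close> by (simp add: mult_left_le)
      then show "\<bar>L x h\<bar> \<le> 2 * K + C" using rem[of x h] K[OF h] K[of 0] by simp
    qed (auto simp: mid)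
  qed
  have "\<bar>F (x + h) - F x - Blinfun (L x) h\<bar> \<le> C * norm h powr p" for x h
    unfolding bounded_linear_Blinfun_apply[OF lin] by (rule rem)
  then show thesis using \<open>C \<ge> 0\<close> by (rule that[rotated])
qed

section \<open>Taylor expansions and Hoelder continuous derivatives\<close>

lemma taylor_imp_has_derivative:
  fixes F :: "'a::real_normed_vector \<Rightarrow> real" and L :: "'a \<Rightarrow>\<^sub>L real"
  assumes "\<alpha> > 0" and taylor: "\<And>h. \<bar>F (x + h) - F x - L h\<bar> \<le> C * norm h powr (1 + \<alpha>)"
  shows "(F has_derivative L) (at x)"
  unfolding has_derivative_at
proof (rule conjI[OF blinfun.bounded_linear_right],
    rule Lim_null_comparison[of _ "\<lambda>h. C * norm h powr \<alpha>"])
  have "norm (norm (F (x + h) - F x - L h) / norm h) \<le> C * norm h powr \<alpha>" for h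
    using taylor[of h] by (cases "h = 0") (auto simp: powr_add field_simps)
  then show "\<forall>\<^sub>F h in at 0. norm (norm (F (x + h) - F x - L h) / norm h) \<le> C * norm h powr \<alpha>"
    by (rule always_eventually[OF allI])
  have "((\<lambda>h::'a. norm h powr \<alpha>) \<longlongrightarrow> 0 powr \<alpha>) (at 0)"
    using \<open>\<alpha> > 0\<close> by (intro tendsto_powr') (auto intro!: tendsto_norm_zero)
  then show "((\<lambda>h::'a. C * norm h powr \<alpha>) \<longlongrightarrow> 0) (at 0)"
    by (auto intro: tendsto_mult_right_zero)
qed

text \<open>Compare the expansions of \<open>F\<close> at \<open>x\<close> and at \<open>y\<close> in the point \<open>x + h\<close> with
  \<open>\<parallel>h\<parallel> = \<parallel>x - y\<parallel>\<close>: all remainders then have the same order.\<close>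

lemma taylor_imp_C1_holder:
  fixes F :: "'a::real_normed_vector \<Rightarrow> real" and DF :: "'a \<Rightarrow> 'a \<Rightarrow>\<^sub>L real"
  assumes "\<alpha> > 0" "C \<ge> 0"
    and taylor: "\<And>x h. \<bar>F (x + h) - F x - DF x h\<bar> \<le> C * norm h powr (1 + \<alpha>)"
  shows "F \<in> C1_holder \<alpha> UNIV"
proof -
  define c where "c = C * (2 + 2 powr (1 + \<alpha>))"
  have "c \<ge> 0" using \<open>C \<ge> 0\<close> by (simp add: c_def)
  have "norm (DF x - DF y) \<le> c * norm (x - y) powr \<alpha>" for x y
  proof (cases "x = y")
    case False
    define d where "d = norm (x - y)"
    have d: "d > 0" using False by (simp add: d_def)
    show ?thesis
    proof (rule norm_blinfun_bound)
      show "0 \<le> c * norm (x - y) powr \<alpha>" using \<open>c \<ge> 0\<close> by simp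
      fix v
      show "norm ((DF x - DF y) v) \<le> c * norm (x - y) powr \<alpha> * norm v"
      proof (cases "v = 0")
        case v: False
        define h where "h = (d / norm v) *\<^sub>R v"
        have nh: "norm h = d" using v d by (simp add: h_def)
        have "norm ((x - y) + h) \<le> 2 * d"
          using norm_triangle_ineq[of "x - y" h] nh by (simp add: d_def)
        then have "norm ((x - y) + h) powr (1 + \<alpha>) \<le> (2 * d) powr (1 + \<alpha>)"
          using \<open>\<alpha> > 0\<close> by (intro powr_mono2) auto
        then have "C * norm ((x - y) + h) powr (1 + \<alpha>) \<le> C * (2 powr (1 + \<alpha>) * d powr (1 + \<alpha>))"
          using d \<open>C \<ge> 0\<close> by (intro mult_left_mono) (auto simp: powr_mult)
        then have "\<bar>F (x + h) - F y - DF y (x - y) - DF y h\<bar>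
            \<le> C * (2 powr (1 + \<alpha>) * d powr (1 + \<alpha>))"
          using taylor[of y "(x - y) + h"] by (simp add: blinfun.add_right)
        moreover have "\<bar>F x - F y - DF y (x - y)\<bar> \<le> C * d powr (1 + \<alpha>)"
          using taylor[of y "x - y"] by (simp add: d_def)
        moreover have "\<bar>F (x + h) - F x - DF x h\<bar> \<le> C * d powr (1 + \<alpha>)"
          using taylor[of x h] nh by simp
        ultimately have "\<bar>DF x h - DF y h\<bar> \<le> c * d powr (1 + \<alpha>)"
          unfolding c_def by (simp add: algebra_simps)
        moreover have "DF x h - DF y h = (d / norm v) * (DF x - DF y) v"
          by (simp add: h_def blinfun.scaleR_right blinfun.diff_left right_diff_distrib)
        ultimately have "(d / norm v) * \<bar>(DF x - DF y) v\<bar> \<le> c * d powr \<alpha> * d"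
          using d by (simp add: abs_mult powr_add mult_ac)
        then show ?thesis
          using d v unfolding d_def[symmetric] by (simp add: field_simps)
      qed simp
    qed
  qed simp
  then have "norm (DF x - DF y) \<le> (c + 1) * norm (x - y) powr \<alpha>" for x y
    by (rule order_trans) (simp add: mult_right_mono)
  moreover have "(F has_derivative DF x) (at x)" for x
    using \<open>\<alpha> > 0\<close> taylor by (rule taylor_imp_has_derivative)
  ultimately show ?thesis
    unfolding C1_holder_def using add_nonneg_pos[OF \<open>c \<ge> 0\<close> zero_less_one] by blast
qed

lemma C1_holder_imp_taylor:
  fixes F :: "'a::real_normed_vector \<Rightarrow> real"
  assumes "F \<in> C1_holder \<alpha> UNIV" "\<alpha> > 0"
  obtains DF :: "'a \<Rightarrow> 'a \<Rightarrow>\<^sub>L real" and M where "M > 0"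
    and "\<And>x y. norm (DF y - DF x) \<le> M * norm (y - x) powr \<alpha>"
    and "\<And>x y. \<bar>F y - F x - DF x (y - x)\<bar> \<le> M * norm (y - x) powr (1 + \<alpha>)"
proof -
  obtain DF :: "'a \<Rightarrow> 'a \<Rightarrow>\<^sub>L real" and M where "M > 0"
    and der: "\<And>x. (F has_derivative DF x) (at x)"
    and hol: "\<And>x y. norm (DF x - DF y) \<le> M * norm (x - y) powr \<alpha>"
    using assms(1) unfolding C1_holder_def by auto
  have "\<bar>F y - F x - DF x (y - x)\<bar> \<le> M * norm (y - x) powr (1 + \<alpha>)" for x y
  proof -
    have "norm (F y - F x - DF x (y - x)) \<le> norm (y - x) * (M * norm (y - x) powr \<alpha>)"
    proof (rule differentiable_bound_linearization[where S = "closed_segment x y"])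
      fix t :: real assume "t \<in> {0..1}"
      then show "x + t *\<^sub>R (y - x) \<in> closed_segment x y"
        by (auto simp: closed_segment_def algebra_simps intro!: exI[of _ t])
    next
      fix z assume z: "z \<in> closed_segment x y"
      have "onorm (blinfun_apply (DF z) - blinfun_apply (DF x)) = norm (DF z - DF x)"
        by (simp add: norm_blinfun.rep_eq minus_blinfun.rep_eq fun_diff_def)
      also have "\<dots> \<le> M * norm (z - x) powr \<alpha>" by (rule hol)
      also have "\<dots> \<le> M * norm (y - x) powr \<alpha>"
        using \<open>M > 0\<close> \<open>\<alpha> > 0\<close> segment_bound1[OF z]
        by (intro mult_left_mono powr_mono2) (auto simp: norm_minus_commute)
      finally show "onorm (blinfun_apply (DF z) - blinfun_apply (DF x))
        \<le> M * norm (y - x) powr \<alpha>" .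
    qed (use der in \<open>auto intro: has_derivative_at_withinI\<close>)
    then show ?thesis by (cases "x = y") (auto simp: powr_add mult_ac)
  qed
  then show thesis using \<open>M > 0\<close> hol by (intro that[of M DF]) auto
qed

section \<open>Powers of smooth norms\<close>

text \<open>The second order remainder of \<open>s powr p\<close> at \<open>s = 1\<close>. Writing \<open>s powr p = s * s powr (p - 1)\<close>
  reduces it to Bernoulli's inequality for the exponent \<open>p - 1 \<le> 1\<close>.\<close>

lemma powr_le_quadratic:
  fixes a r p :: real
  assumes "a \<ge> 0" "r > 0" "1 < p" "p \<le> 2"
  shows "a powr p \<le> r powr p + p * r powr (p - 1) * (a - r) + (p - 1) * r powr (p - 2) * (a - r)\<^sup>2"
proof -
  define s where "s = a / r"
  have s: "s \<ge> 0" "a = r * s" using assms by (auto simp: s_def)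
  have "s powr (p - 1) * 1 powr (2 - p) \<le> (p - 1) * s + (2 - p) * 1"
  proof (cases "s = 0")
    case False
    then show ?thesis using assms s(1) by (intro Youngs_inequality_0) auto
  qed (use \<open>p \<le> 2\<close> in simp)
  then have "s * s powr (p - 1) \<le> s * (1 + (p - 1) * (s - 1))"
    using s by (intro mult_left_mono) (auto simp: algebra_simps)
  moreover have "s powr p = s * s powr (p - 1)"
    using powr_mult_base[OF s(1), of "p - 1"] by simp
  ultimately have "s powr p \<le> 1 + p * (s - 1) + (p - 1) * (s - 1)\<^sup>2"
    by (simp add: algebra_simps power2_eq_square)
  then have "r powr p * s powr p \<le> r powr p * (1 + p * (s - 1) + (p - 1) * (s - 1)\<^sup>2)"
    by (intro mult_left_mono) auto
  also have "\<dots> = r powr p + p * (r powr p / r) * (a - r) + (p - 1) * (r powr p / r\<^sup>2) * (a - r)\<^sup>2"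
    using \<open>r > 0\<close> unfolding s by (simp add: field_simps power2_eq_square)
  finally show ?thesis
    using \<open>r > 0\<close> s by (simp add: powr_mult powr_diff)
qed

text \<open>By homogeneity the modulus controls second differences of \<open>N\<close> at every nonzero point.\<close>

lemma smooth_norm_second_difference:
  fixes N :: "'a::real_vector \<Rightarrow> real"
  assumes N: "is_norm N" and "p > 1"
    and K: "\<And>\<tau>. \<tau> \<ge> 0 \<Longrightarrow> modulus_of_smoothness N \<tau> \<le> K * \<tau> powr p"
    and "N x > 0" "N h > 0"
  shows "N (x + h) + N (x - h) - 2 * N x \<le> 2 * K * N h powr p * N x powr (1 - p)"
proof -
  have hom: "N (c *\<^sub>R v) = \<bar>c\<bar> * N v" and tri: "N (v + w) \<le> N v + N w" for c v w
    using N by (auto simp: is_norm_def)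
  define X where "X = (1 / N x) *\<^sub>R x"
  define Y where "Y = (1 / N h) *\<^sub>R h"
  define \<tau> where "\<tau> = N h / N x"
  have unit: "N X = 1" "N Y = 1" and "\<tau> > 0" using assms by (auto simp: X_def Y_def \<tau>_def hom)
  let ?S = "{(N (v + \<tau> *\<^sub>R w) + N (v - \<tau> *\<^sub>R w)) / 2 - 1 | v w. N v = 1 \<and> N w = 1}"
  have "bdd_above (insert 0 ?S)"
  proof (rule bdd_aboveI[of _ \<tau>])
    fix m assume "m \<in> insert 0 ?S"
    then show "m \<le> \<tau>"
    proof
      assume "m \<in> ?S"
      then obtain v w where m: "m = (N (v + \<tau> *\<^sub>R w) + N (v - \<tau> *\<^sub>R w)) / 2 - 1"
        and "N v = 1" "N w = 1" by blast
      then show ?thesis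
        using tri[of v "\<tau> *\<^sub>R w"] tri[of v "(-\<tau>) *\<^sub>R w"] hom[of \<tau> w] hom[of "-\<tau>" w] \<open>\<tau> > 0\<close>
        by (simp add: field_simps)
    qed (use \<open>\<tau> > 0\<close> in simp)
  qed
  then have "(N (X + \<tau> *\<^sub>R Y) + N (X - \<tau> *\<^sub>R Y)) / 2 - 1 \<le> modulus_of_smoothness N \<tau>"
    unfolding modulus_of_smoothness_def using unit by (intro cSup_upper) auto
  also have "\<dots> \<le> K * \<tau> powr p" using \<open>\<tau> > 0\<close> by (intro K) simp
  finally have *: "(N (X + \<tau> *\<^sub>R Y) + N (X - \<tau> *\<^sub>R Y)) / 2 - 1 \<le> K * \<tau> powr p" .
  have "X + \<tau> *\<^sub>R Y = (1 / N x) *\<^sub>R (x + h)" "X - \<tau> *\<^sub>R Y = (1 / N x) *\<^sub>R (x - h)"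
    using assms by (auto simp: X_def Y_def \<tau>_def algebra_simps)
  then have "N (X + \<tau> *\<^sub>R Y) = N (x + h) / N x" "N (X - \<tau> *\<^sub>R Y) = N (x - h) / N x"
    using assms by (auto simp: hom)
  with * have "(N (x + h) / N x + N (x - h) / N x) / 2 - 1 \<le> K * \<tau> powr p" by simp
  then have "N x * ((N (x + h) / N x + N (x - h) / N x) / 2 - 1) \<le> N x * (K * \<tau> powr p)"
    using assms by (intro mult_left_mono) auto
  moreover have "N x * ((N (x + h) / N x + N (x - h) / N x) / 2 - 1)
      = (N (x + h) + N (x - h) - 2 * N x) / 2"
    using assms by (simp add: field_simps)
  moreover have "N x * (K * \<tau> powr p) = K * N h powr p * N x powr (1 - p)"
    using assms by (simp add: \<tau>_def powr_divide powr_diff)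
  ultimately show ?thesis by simp
qed

text \<open>Where \<open>N h\<close> dominates \<open>N x\<close> the triangle inequality suffices. Elsewhere expand \<open>s powr p\<close>
  around \<open>s = N x\<close>: the linear terms add up to a second difference of \<open>N\<close>, whose blow-up
  \<open>N x powr (1 - p)\<close> at the origin is exactly cancelled by the factor \<open>N x powr (p - 1)\<close>,
  and the quadratic terms are harmless because \<open>N x powr (p - 2) \<le> N h powr (p - 2)\<close> for \<open>p \<le> 2\<close>.\<close>

lemma smooth_norm_powr_second_difference:
  fixes N :: "'a::real_vector \<Rightarrow> real"
  assumes N: "is_norm N" and "smoothness_power_type N p" "p \<le> 2"
  obtains D where "D \<ge> 0"
    and "\<And>x h. second_difference (\<lambda>x. N x powr p) x h \<le> D * N h powr p"
proof -
  have zero: "N v = 0 \<longleftrightarrow> v = 0" and hom: "N (c *\<^sub>R v) = \<bar>c\<bar> * N v"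
    and tri: "N (v + w) \<le> N v + N w" for c v w
    using N by (auto simp: is_norm_def)
  have minus: "N (- v) = N v" for v using hom[of "-1" v] by simp
  have nonneg: "N v \<ge> 0" for v using tri[of v "- v"] minus[of v] zero[of 0] by simp
  obtain K where "p > 1" "K > 0"
    and K: "\<And>\<tau>. \<tau> \<ge> 0 \<Longrightarrow> modulus_of_smoothness N \<tau> \<le> K * \<tau> powr p"
    using assms(2) unfolding smoothness_power_type_def by auto
  define D where "D = 2 * 2 powr p + 2 * K * p + 2 * (p - 1)"
  have "D \<ge> 0" using \<open>K > 0\<close> \<open>p > 1\<close> by (simp add: D_def)
  have "second_difference (\<lambda>x. N x powr p) x h \<le> D * N h powr p" for x h
  proof (cases "h = 0")
    case True
    then show ?thesis using \<open>D \<ge> 0\<close> by (simp add: second_difference_def)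
  next
    case False
    define r t a b where "r = N x" "t = N h" "a = N (x + h)" "b = N (x - h)"
    note defs = this
    have "t > 0" "r \<ge> 0" "a \<ge> 0" "b \<ge> 0"
      using False nonneg zero unfolding defs by (auto simp: less_le)
    have ab: "a \<le> r + t" "b \<le> r + t" "r \<le> a + t" "r \<le> b + t"
      using tri[of x h] tri[of x "-h"] tri[of "x + h" "- h"] tri[of "x - h" h] minus
      unfolding defs by auto
    have "a powr p + b powr p - 2 * r powr p \<le> D * t powr p"
    proof (cases "r \<le> t")
      case True
      have "a powr p \<le> (2 * t) powr p" "b powr p \<le> (2 * t) powr p"
        using ab True \<open>a \<ge> 0\<close> \<open>b \<ge> 0\<close> \<open>p > 1\<close> by (auto intro!: powr_mono2)
      then have "a powr p + b powr p - 2 * r powr p \<le> 2 * 2 powr p * t powr p"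
        using \<open>t > 0\<close> powr_ge_zero[of r p] unfolding powr_mult by linarith
      also have "\<dots> \<le> D * t powr p"
        unfolding D_def using \<open>K > 0\<close> \<open>p > 1\<close> by (intro mult_right_mono) auto
      finally show ?thesis .
    next
      case rt: False
      then have "r > 0" using \<open>t > 0\<close> by simp
      have sq: "(p - 1) * r powr (p - 2) * (c - r)\<^sup>2 \<le> (p - 1) * t powr p" if "\<bar>c - r\<bar> \<le> t" for c
      proof -
        have "(c - r)\<^sup>2 \<le> t\<^sup>2" using that by (simp add: abs_le_square_iff[symmetric])
        moreover have "r powr (p - 2) \<le> t powr (p - 2)"
          using rt \<open>t > 0\<close> \<open>p \<le> 2\<close> by (intro powr_mono2') auto
        ultimately have "r powr (p - 2) * (c - r)\<^sup>2 \<le> t powr (p - 2) * t\<^sup>2"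
          by (intro mult_mono) auto
        also have "\<dots> = t powr p" using \<open>t > 0\<close> by (simp add: powr_diff)
        finally show ?thesis using \<open>p > 1\<close> by (simp add: mult.assoc mult_left_mono)
      qed
      have "a + b - 2 * r \<le> 2 * K * t powr p * r powr (1 - p)"
        using smooth_norm_second_difference[OF N \<open>p > 1\<close> K, of x h] \<open>t > 0\<close> \<open>r > 0\<close>
        unfolding defs by simp
      then have "p * r powr (p - 1) * (a + b - 2 * r)
          \<le> p * r powr (p - 1) * (2 * K * t powr p * r powr (1 - p))"
        using \<open>p > 1\<close> by (intro mult_left_mono) auto
      also have "\<dots> = 2 * K * p * t powr p * (r powr (p - 1) * r powr (1 - p))"
        by (simp add: mult_ac)
      also have "r powr (p - 1) * r powr (1 - p) = 1"
        using \<open>r > 0\<close> by (simp add: powr_add[symmetric])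
      finally have lin: "p * r powr (p - 1) * (a + b - 2 * r) \<le> 2 * K * p * t powr p" by simp
      have "a powr p + b powr p - 2 * r powr p
        \<le> p * r powr (p - 1) * (a + b - 2 * r)
          + (p - 1) * r powr (p - 2) * (a - r)\<^sup>2 + (p - 1) * r powr (p - 2) * (b - r)\<^sup>2"
        using powr_le_quadratic[OF \<open>a \<ge> 0\<close> \<open>r > 0\<close> \<open>p > 1\<close> \<open>p \<le> 2\<close>]
          powr_le_quadratic[OF \<open>b \<ge> 0\<close> \<open>r > 0\<close> \<open>p > 1\<close> \<open>p \<le> 2\<close>]
        by (simp add: algebra_simps)
      also have "\<dots> \<le> 2 * K * p * t powr p + (p - 1) * t powr p + (p - 1) * t powr p"
        using lin sq[of a] sq[of b] ab by (intro add_mono) auto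
      also have "\<dots> \<le> D * t powr p" unfolding D_def by (simp add: algebra_simps)
      finally show ?thesis .
    qed
    then show ?thesis unfolding second_difference_def defs .
  qed
  then show thesis using \<open>D \<ge> 0\<close> by (rule that[rotated])
qed

section \<open>The extension theorem\<close>

text \<open>The compatibility condition compares the first order polynomials of two points \<open>y\<close>, \<open>z\<close> at a
  third point \<open>x\<close>; since \<open>\<parallel>y - z\<parallel>\<close> is at most twice the larger of the distances of \<open>x\<close> from \<open>y\<close>
  and \<open>z\<close>, all errors are of that order.\<close>

lemma jet_difference_bound:
  fixes f :: "'a::real_normed_vector \<Rightarrow> real" and G :: "'a \<Rightarrow> 'a \<Rightarrow>\<^sub>L real"
  assumes "0 < \<alpha>" "\<alpha> \<le> 1" "M > 0"
    and G: "norm (G y - G z) \<le> M * norm (y - z) powr \<alpha>"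
    and f: "\<bar>f y - f z - G z (y - z)\<bar> \<le> M * norm (y - z) powr (1 + \<alpha>)"
  shows "(f y + G y (x - y)) - (f z + G z (x - z))
    \<le> 6 * M * (norm (x - y) powr (1 + \<alpha>) + norm (x - z) powr (1 + \<alpha>))"
proof -
  define m where "m = max (norm (x - y)) (norm (x - z))"
  have m: "norm (x - y) \<le> m" "norm (x - z) \<le> m" "m \<ge> 0" by (auto simp: m_def le_max_iff_disj)
  have yz: "norm (y - z) \<le> 2 * m"
    using norm_triangle_ineq4[of "x - z" "x - y"] m by simp
  have two: "2 powr (1 + \<alpha>) \<le> (2::real) powr 2" "2 powr \<alpha> \<le> (2::real) powr 1"
    using \<open>\<alpha> \<le> 1\<close> by (intro powr_mono; simp)+
  have "norm (y - z) powr (1 + \<alpha>) \<le> (2 * m) powr (1 + \<alpha>)"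
    using yz \<open>0 < \<alpha>\<close> by (intro powr_mono2) auto
  also have "\<dots> \<le> 4 * m powr (1 + \<alpha>)"
    using two m by (simp add: powr_mult mult_right_mono)
  finally have 1: "M * norm (y - z) powr (1 + \<alpha>) \<le> M * (4 * m powr (1 + \<alpha>))"
    using \<open>M > 0\<close> by (intro mult_left_mono) auto
  have "norm (y - z) powr \<alpha> \<le> (2 * m) powr \<alpha>"
    using yz \<open>0 < \<alpha>\<close> by (intro powr_mono2) auto
  also have "\<dots> \<le> 2 * m powr \<alpha>"
    using two m by (simp add: powr_mult mult_right_mono)
  finally have "M * norm (y - z) powr \<alpha> \<le> M * (2 * m powr \<alpha>)"
    using \<open>M > 0\<close> by (intro mult_left_mono) auto
  with G have "norm (G y - G z) \<le> M * (2 * m powr \<alpha>)" by (rule order_trans)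
  then have "norm (G y - G z) * norm (x - y) \<le> M * (2 * m powr \<alpha>) * m"
    using m \<open>M > 0\<close> by (intro mult_mono) auto
  also have "\<dots> = M * (2 * m powr (1 + \<alpha>))"
    using m by (cases "m = 0") (auto simp: powr_add)
  finally have 2: "\<bar>(G y - G z) (x - y)\<bar> \<le> M * (2 * m powr (1 + \<alpha>))"
    using norm_blinfun[of "G y - G z" "x - y"] by simp
  have "(f y + G y (x - y)) - (f z + G z (x - z))
      = (f y - f z - G z (y - z)) + (G y - G z) (x - y)"
    by (simp add: blinfun.diff_left blinfun.diff_right)
  also have "\<dots> \<le> 6 * M * m powr (1 + \<alpha>)" using f 1 2 by simp
  also have "\<dots> \<le> 6 * M * (norm (x - y) powr (1 + \<alpha>) + norm (x - z) powr (1 + \<alpha>))"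
    using \<open>M > 0\<close> by (intro mult_left_mono) (auto simp: m_def max_def)
  finally show ?thesis .
qed

lemma second_difference_affine_plus:
  fixes G :: "'a::real_normed_vector \<Rightarrow>\<^sub>L real"
  shows "second_difference (\<lambda>x. c + G (x - y) + A * \<phi> (x - y)) x h
    = A * second_difference \<phi> (x - y) h"
  unfolding second_difference_def
  by (simp add: blinfun.diff_right blinfun.add_right algebra_simps)

text \<open>The majorants \<open>u y\<close> and minorants \<open>l y\<close> both have the prescribed first order jet at \<open>y\<close> and
  differ by \<open>O(\<parallel>x - y\<parallel>\<^sup>p)\<close>, so anything inserted between them inherits value and derivative there.
  Already one such pair makes the inserted function bounded on bounded sets.\<close>

lemma C1_holder_extension:
  fixes f N :: "'a::real_normed_vector \<Rightarrow> real" and G :: "'a \<Rightarrow> 'a \<Rightarrow>\<^sub>L real"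
  assumes \<alpha>: "0 < \<alpha>" "\<alpha> \<le> 1"
    and eqN: "equivalent_norm N" and smooth: "smoothness_power_type N (1 + \<alpha>)" and "M > 0"
    and G: "\<And>x y. x \<in> E \<Longrightarrow> y \<in> E \<Longrightarrow> norm (G y - G x) \<le> M * norm (y - x) powr \<alpha>"
    and f: "\<And>x y. x \<in> E \<Longrightarrow> y \<in> E \<Longrightarrow>
      \<bar>f y - f x - G x (y - x)\<bar> \<le> M * norm (y - x) powr (1 + \<alpha>)"
  obtains F where "F \<in> C1_holder \<alpha> UNIV" "\<And>x. x \<in> E \<Longrightarrow> F x = f x"
    "\<And>x. x \<in> E \<Longrightarrow> (F has_derivative G x) (at x)"
proof (cases "E = {}")
  case True
  have "(\<lambda>x::'a. 0) \<in> C1_holder \<alpha> UNIV"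
    by (rule taylor_imp_C1_holder[of \<alpha> 0 _ "\<lambda>_. 0"]) (use \<alpha> in auto)
  then show thesis using True by (intro that) auto
next
  case False
  then obtain e where "e \<in> E" by auto
  define p where "p = 1 + \<alpha>"
  have p: "1 < p" "p \<le> 2" using \<alpha> by (auto simp: p_def)
  obtain a b where "a > 0" "b > 0" and N: "is_norm N"
    and a: "\<And>x. a * norm x \<le> N x" and b: "\<And>x. N x \<le> b * norm x"
    using eqN unfolding equivalent_norm_def by blast
  define \<phi> where "\<phi> x = N x powr p" for x
  obtain D where "D \<ge> 0" and D: "\<And>x h. second_difference \<phi> x h \<le> D * N h powr p"
    using smooth_norm_powr_second_difference[OF N smooth[folded p_def] p(2)]
    unfolding \<phi>_def by blast
  have \<phi>_low: "a powr p * norm x powr p \<le> \<phi> x" for x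
  proof -
    have "(a * norm x) powr p \<le> N x powr p"
      using a p \<open>a > 0\<close> by (intro powr_mono2) auto
    then show ?thesis using \<open>a > 0\<close> by (simp add: \<phi>_def powr_mult)
  qed
  have \<phi>_up: "\<phi> x \<le> b powr p * norm x powr p" for x
  proof -
    have "0 \<le> a * norm x" using \<open>a > 0\<close> by simp
    then have "0 \<le> N x" using a by (rule order_trans)
    then have "N x powr p \<le> (b * norm x) powr p"
      using b p by (intro powr_mono2) auto
    then show ?thesis using \<open>b > 0\<close> by (simp add: \<phi>_def powr_mult)
  qed
  have \<phi>0: "\<phi> 0 = 0" using N by (simp add: \<phi>_def is_norm_def)
  \<comment> \<open>\<open>A\<close> turns the error of \<open>jet_difference_bound\<close> into multiples of \<open>\<phi>\<close>, so that the
    minorants \<open>l\<close> below stay under the majorants \<open>u\<close>.\<close>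
  define A where "A = 6 * M / a powr p"
  have "A > 0" using \<open>M > 0\<close> \<open>a > 0\<close> by (simp add: A_def)
  have A: "6 * M * norm x powr p \<le> A * \<phi> x" for x
    using mult_left_mono[OF \<phi>_low, of A x] \<open>A > 0\<close> \<open>a > 0\<close> by (simp add: A_def)
  define B where "B = A * D * b powr p"
  have sd: "A * second_difference \<phi> x h \<le> B * norm h powr p" for x h
  proof -
    have "A * second_difference \<phi> x h \<le> A * (D * \<phi> h)"
      using D \<open>A > 0\<close> unfolding \<phi>_def by (intro mult_left_mono) auto
    also have "\<dots> \<le> A * (D * (b powr p * norm h powr p))"
      using \<phi>_up \<open>A > 0\<close> \<open>D \<ge> 0\<close> by (intro mult_left_mono) auto
    finally show ?thesis by (simp add: B_def mult_ac)
  qed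
  define l where "l y x = f y + G y (x - y) - A * \<phi> (x - y)" for y x
  define u where "u y x = f y + G y (x - y) + A * \<phi> (x - y)" for y x
  have sd_u: "second_difference (u y) x h = A * second_difference \<phi> (x - y) h" for x y h
    unfolding u_def by (rule second_difference_affine_plus)
  have sd_l: "second_difference (l y) x h = - A * second_difference \<phi> (x - y) h" for x y h
    using second_difference_affine_plus[of "f y" "G y" y "- A" \<phi> x h] unfolding l_def by simp
  obtain F where F: "\<And>x h. \<bar>second_difference F x h\<bar> \<le> B * norm h powr p"
    and above: "\<And>l' x. l' \<in> l ` E \<Longrightarrow> l' x \<le> F x"
    and below: "\<And>u' x. u' \<in> u ` E \<Longrightarrow> F x \<le> u' x"
  proof (rule second_difference_insertion[of "u ` E" "l ` E" "\<lambda>h. B * norm h powr p"])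
    show "l' x \<le> u' x" if l': "l' \<in> l ` E" and u': "u' \<in> u ` E" for l' u' x
    proof -
      from l' u' obtain y z where yz: "y \<in> E" "z \<in> E" and eq: "l' = l y" "u' = u z" by blast
      have "(f y + G y (x - y)) - (f z + G z (x - z))
          \<le> 6 * M * (norm (x - y) powr (1 + \<alpha>) + norm (x - z) powr (1 + \<alpha>))"
        by (rule jet_difference_bound[OF \<alpha> \<open>M > 0\<close> G[OF yz(2,1)] f[OF yz(2,1)]])
      also have "\<dots> \<le> A * \<phi> (x - y) + A * \<phi> (x - z)"
        using A[of "x - y"] A[of "x - z"] by (simp add: p_def algebra_simps)
      finally show ?thesis unfolding eq l_def u_def by simp
    qed
  qed (use False sd in \<open>auto simp: sd_u sd_l\<close>)
  have lF: "l y x \<le> F x" and Fu: "F x \<le> u y x" if "y \<in> E" for x y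
    using above below that by auto
  have approx: "\<bar>F x - f y - G y (x - y)\<bar> \<le> A * b powr p * norm (x - y) powr p" if "y \<in> E" for x y
  proof -
    have "\<bar>F x - f y - G y (x - y)\<bar> \<le> A * \<phi> (x - y)"
      using lF[OF that, of x] Fu[OF that, of x] unfolding l_def u_def by simp
    also have "\<dots> \<le> A * (b powr p * norm (x - y) powr p)"
      using \<phi>_up \<open>A > 0\<close> by (intro mult_left_mono) auto
    finally show ?thesis by (simp add: mult.assoc)
  qed
  have Ff: "F y = f y" if "y \<in> E" for y using approx[OF that, of y] p by simp
  have loc: "\<exists>K. \<forall>h. norm h \<le> 1 \<longrightarrow> \<bar>F (x + h)\<bar> \<le> K" for x
  proof (intro exI allI impI)
    fix h :: 'a assume h: "norm h \<le> 1"
    define R where "R = norm (x - e) + 1"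
    have R: "norm (x + h - e) \<le> R"
      using norm_triangle_ineq[of "x - e" h] h by (simp add: R_def algebra_simps)
    have "norm (G e (x + h - e)) \<le> norm (G e) * R"
      using norm_blinfun[of "G e" "x + h - e"] mult_left_mono[OF R norm_ge_zero[of "G e"]] by linarith
    moreover have "A * b powr p * norm (x + h - e) powr p \<le> A * b powr p * R powr p"
      using R p \<open>A > 0\<close> by (intro mult_left_mono powr_mono2) auto
    ultimately show "\<bar>F (x + h)\<bar> \<le> \<bar>f e\<bar> + norm (G e) * (norm (x - e) + 1)
        + A * b powr p * (norm (x - e) + 1) powr p"
      using approx[OF \<open>e \<in> E\<close>, of "x + h"] unfolding R_def real_norm_def by linarith
  qed
  obtain DF :: "'a \<Rightarrow> 'a \<Rightarrow>\<^sub>L real" and C where "C \<ge> 0"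
    and taylor: "\<And>x h. \<bar>F (x + h) - F x - DF x h\<bar> \<le> C * norm h powr p"
    by (rule second_difference_imp_taylor[OF p(1) F loc]) (rule that)
  have "(F has_derivative G y) (at y)" if "y \<in> E" for y
  proof (rule taylor_imp_has_derivative[OF \<alpha>(1)])
    show "\<bar>F (y + h) - F y - G y h\<bar> \<le> A * b powr p * norm h powr (1 + \<alpha>)" for h
      using approx[OF that, of "y + h"] by (simp add: Ff[OF that] p_def)
  qed
  then show thesis
    using taylor_imp_C1_holder[OF \<alpha>(1) \<open>C \<ge> 0\<close> taylor[unfolded p_def]] Ff by (intro that[of F])
qed

theorem theorem47:
  fixes \<alpha> :: real and E :: "'a::banach set" and f :: "'a \<Rightarrow> real"
  assumes "0 < \<alpha>" and "\<alpha> \<le> 1"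
    and "super_reflexive TYPE('a)"
    and "\<exists>N :: 'a \<Rightarrow> real. equivalent_norm N \<and> smoothness_power_type N (1 + \<alpha>)"
  shows "((\<exists>F \<in> C1_holder \<alpha> UNIV. \<forall>x\<in>E. F x = f x) \<longleftrightarrow>
          (\<exists>(G :: 'a \<Rightarrow> 'a \<Rightarrow>\<^sub>L real). \<exists>M>0. \<forall>x\<in>E. \<forall>y\<in>E.
             norm (G y - G x) \<le> M * norm (y - x) powr \<alpha> \<and>
             \<bar>f y - f x - blinfun_apply (G x) (y - x)\<bar> \<le> M * norm (y - x) powr (1 + \<alpha>)))
       \<and> (\<forall>G :: 'a \<Rightarrow> 'a \<Rightarrow>\<^sub>L real.
            (\<exists>M>0. \<forall>x\<in>E. \<forall>y\<in>E.
               norm (G y - G x) \<le> M * norm (y - x) powr \<alpha> \<and>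
               \<bar>f y - f x - blinfun_apply (G x) (y - x)\<bar> \<le> M * norm (y - x) powr (1 + \<alpha>)) \<longrightarrow>
            (\<exists>F \<in> C1_holder \<alpha> UNIV.
               (\<forall>x\<in>E. F x = f x) \<and>
               (\<forall>x\<in>E. (F has_derivative blinfun_apply (G x)) (at x))))"
proof -
  let ?jet = "\<lambda>G :: 'a \<Rightarrow> 'a \<Rightarrow>\<^sub>L real. \<exists>M>0. \<forall>x\<in>E. \<forall>y\<in>E.
      norm (G y - G x) \<le> M * norm (y - x) powr \<alpha> \<and>
      \<bar>f y - f x - blinfun_apply (G x) (y - x)\<bar> \<le> M * norm (y - x) powr (1 + \<alpha>)"
  obtain N :: "'a \<Rightarrow> real" where N: "equivalent_norm N" "smoothness_power_type N (1 + \<alpha>)"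
    using assms(4) by blast
  have suff: "\<exists>F \<in> C1_holder \<alpha> UNIV. (\<forall>x\<in>E. F x = f x) \<and>
      (\<forall>x\<in>E. (F has_derivative blinfun_apply (G x)) (at x))" if jet: "?jet G" for G
  proof -
    from jet obtain M where "M > 0"
      and "\<And>x y. x \<in> E \<Longrightarrow> y \<in> E \<Longrightarrow> norm (G y - G x) \<le> M * norm (y - x) powr \<alpha>"
      and "\<And>x y. x \<in> E \<Longrightarrow> y \<in> E \<Longrightarrow>
        \<bar>f y - f x - G x (y - x)\<bar> \<le> M * norm (y - x) powr (1 + \<alpha>)"
      by blast
    from C1_holder_extension[OF assms(1,2) N this] obtain F where "F \<in> C1_holder \<alpha> UNIV"
      "\<And>x. x \<in> E \<Longrightarrow> F x = f x" "\<And>x. x \<in> E \<Longrightarrow> (F has_derivative G x) (at x)"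
      by blast
    then show ?thesis by blast
  qed
  have nec: "\<exists>G. ?jet G" if F: "F \<in> C1_holder \<alpha> UNIV" and ext: "\<forall>x\<in>E. F x = f x" for F
  proof -
    obtain DF :: "'a \<Rightarrow> 'a \<Rightarrow>\<^sub>L real" and M where "M > 0"
      and hol: "\<And>x y. norm (DF y - DF x) \<le> M * norm (y - x) powr \<alpha>"
      and tay: "\<And>x y. \<bar>F y - F x - DF x (y - x)\<bar> \<le> M * norm (y - x) powr (1 + \<alpha>)"
      by (rule C1_holder_imp_taylor[OF F assms(1)]) (rule that)
    have "\<bar>f y - f x - DF x (y - x)\<bar> \<le> M * norm (y - x) powr (1 + \<alpha>)" if "x \<in> E" "y \<in> E" for x y
      using tay[of y x] ext that by simp
    with hol \<open>M > 0\<close> show ?thesis by blast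
  qed
  show ?thesis
  proof (intro conjI iffI allI impI)
    assume "\<exists>F \<in> C1_holder \<alpha> UNIV. \<forall>x\<in>E. F x = f x"
    then obtain F where "F \<in> C1_holder \<alpha> UNIV" "\<forall>x\<in>E. F x = f x" by blast
    then show "\<exists>G. ?jet G" by (rule nec)
  next
    assume "\<exists>G. ?jet G"
    then obtain G where "?jet G" by (rule exE)
    from suff[OF this] show "\<exists>F \<in> C1_holder \<alpha> UNIV. \<forall>x\<in>E. F x = f x" by blast
  next
    fix G assume "?jet G"
    then show "\<exists>F \<in> C1_holder \<alpha> UNIV. (\<forall>x\<in>E. F x = f x) \<and>
      (\<forall>x\<in>E. (F has_derivative blinfun_apply (G x)) (at x))"
      by (rule suff)
  qed
qed

end
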